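(* Let $\lambda_r>0$, $\lambda_t>0$ and $T>0$, and consider a protocol $P$ whose randomization intervals are i.i.d. $\mathrm{Exp}(\lambda_r)$ and whose transmission intervals are i.i.d. $\mathrm{Exp}(\lambda_t)$. For two location-indistinguishable devices, let $p_{\mathrm{mix}}$ be the probability that their identifiers have mixed after the first mixing opportunity within duration $T$. Then, with $B=\lambda_r+\lambda_t$, $$p_{\mathrm{mix}}\;\le\;\lambda_r\left(\frac{1}{B}+\frac{\lambda_t}{B^2}\right)\left(1-e^{-2\lambda_r T}\right)\;\le\;\lambda_r\left(\frac{1}{B}+\frac{\lambda_t}{B^2}\right).$$
   Context: $\mathrm{Exp}(\lambda)$ denotes the exponential distribution with rate $\lambda$. Two devices run the same protocol $P$ and are location-indistinguishable during the whole time window $[0,T]$. Each device occasionally replaces its identifier by a fresh one ("randomizes" or "rotates") and occasionally transmits its current identifier, which is then seen by a passive adversary. The randomization and transmission processes are mutually independent, and those of one device are independent of those of the other. Mixing requires two conditions. (1) Both devices randomize at least once within $[0,T]$. (2) After the first transmission of the new identifier by the device that randomizes first, the other device does not transmit its old identifier (i.e. does not transmit before it has itself randomized). The event of mixing at the first mixing opportunity is formalized as follows. Let $R_1,R_2\sim\mathrm{Exp}(\lambda_r)$ be the times of the first randomization of device 1 and device 2, and let $X_1,X_2\sim\mathrm{Exp}(\lambda_t)$, with $R_1,R_2,X_1,X_2$ independent. The device that randomizes first does so at time $\min(R_1,R_2)$, and first transmits its new identifier at time $T_1=\min(R_1,R_2)+X_1$. The other device randomizes at time $\max(R_1,R_2)$,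 and its first transmission after $T_1$ occurs at time $T_2=\min(R_1,R_2)+X_1+X_2$. The devices mix at the first opportunity if and only if $\max(R_1,R_2)\le T$ and $T_2>\max(R_1,R_2)$. Thus $$p_{\mathrm{mix}}=\Pr\big[\max(R_1,R_2)\le T\ \text{ and }\ \min(R_1,R_2)+X_1+X_2>\max(R_1,R_2)\big].$$ *)

theory Defs
  imports "HOL-Probability.Probability"
begin

text \<open>
  \<open>R1\<close>, \<open>R2\<close> are the times of the first randomizations of the two devices.
  \<open>X1\<close> is the waiting time from the earlier randomization to the first transmission of the
  new identifier, and \<open>X2\<close> the further waiting time until the other device transmits.
  The four variables are jointly (not only pairwise) independent.
\<close>

locale two_device_model = prob_space M
  for M :: "'a measure"
    and lambda_r lambda_t :: real
    and R1 R2 X1 X2 :: "'a \<Rightarrow> real" +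
  assumes distr_R1: "distributed M lborel R1 (exponential_density lambda_r)"
    and distr_R2: "distributed M lborel R2 (exponential_density lambda_r)"
    and distr_X1: "distributed M lborel X1 (exponential_density lambda_t)"
    and distr_X2: "distributed M lborel X2 (exponential_density lambda_t)"
    and indep: "indep_vars (\<lambda>_. borel) (\<lambda>i. [R1, R2, X1, X2] ! i) {..<4}"

definition first_transmission ::
    "('a \<Rightarrow> real) \<Rightarrow> ('a \<Rightarrow> real) \<Rightarrow> ('a \<Rightarrow> real) \<Rightarrow> 'a \<Rightarrow> real" where
  "first_transmission R1 R2 X1 \<omega> = min (R1 \<omega>) (R2 \<omega>) + X1 \<omega>"

definition other_transmission ::
    "('a \<Rightarrow> real) \<Rightarrow> ('a \<Rightarrow> real) \<Rightarrow> ('a \<Rightarrow> real) \<Rightarrow> ('a \<Rightarrow> real) \<Rightarrow> 'a \<Rightarrow> real" where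
  "other_transmission R1 R2 X1 X2 \<omega> = first_transmission R1 R2 X1 \<omega> + X2 \<omega>"

definition devices_mix ::
    "real \<Rightarrow> ('a \<Rightarrow> real) \<Rightarrow> ('a \<Rightarrow> real) \<Rightarrow> ('a \<Rightarrow> real) \<Rightarrow> ('a \<Rightarrow> real) \<Rightarrow> 'a \<Rightarrow> bool" where
  "devices_mix T R1 R2 X1 X2 \<omega> \<longleftrightarrow>
     max (R1 \<omega>) (R2 \<omega>) \<le> T \<and>
     other_transmission R1 R2 X1 X2 \<omega> > max (R1 \<omega>) (R2 \<omega>)"

definition p_mix ::
    "'a measure \<Rightarrow> real \<Rightarrow> ('a \<Rightarrow> real) \<Rightarrow> ('a \<Rightarrow> real) \<Rightarrow> ('a \<Rightarrow> real) \<Rightarrow> ('a \<Rightarrow> real) \<Rightarrow> real" where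
  "p_mix M T R1 R2 X1 X2 = measure M {\<omega> \<in> space M. devices_mix T R1 R2 X1 X2 \<omega>}"

end

theory Submission imports Defs begin

text \<open>
  Drop the condition on the later randomization and keep only \<open>min R1 R2 \<le> T\<close>. On the event that
  device 1 is first, mixing then means \<open>R1 \<le> T\<close> and \<open>R1 \<le> R2 \<le> R1 + S\<close> with \<open>S = X1 + X2\<close>.
  Integrating out \<open>R2\<close> leaves the expectation of \<open>exp (- r R1) (1 - exp (- r S))\<close> over \<open>R1 \<le> T\<close>,
  which factors by independence into \<open>(1 - exp (- 2 r T)) / 2\<close> and \<open>1 - (t / (r + t))\<^sup>2\<close>, the latter
  through the Laplace transform of \<open>S\<close>. The other order of the devices contributes the same amount.
\<close>

lemma (in prob_space) exponential_distributed_nonneg: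
  assumes "distributed M lborel X (exponential_density l)"
  shows "AE \<omega> in M. 0 \<le> X \<omega>"
  by (subst distributed_AE2[OF assms]) (auto simp: exponential_density_def)

text \<open>Exponential tilting: multiplying the density of rate \<open>l\<close> by
  \<open>exp (- s * x)\<close> gives \<open>l / (l + s)\<close> times the density of rate
  \<open>l + s\<close>. The cutoff at \<open>T\<close> then turns the remaining integral into the
  distribution function of that faster exponential.\<close>

lemma (in prob_space) exponential_distributed_truncated_laplace:
  assumes X: "distributed M lborel X (exponential_density l)"
    and l: "0 < l" and s: "0 \<le> s" and T: "0 \<le> T"
  shows "expectation (\<lambda>\<omega>. indicator {..T} (X \<omega>) * exp (- s * X \<omega>)) =
    l / (l + s) * (1 - exp (- (l + s) * T))"
proof (rule has_bochner_integral_integral_eq, rule has_bochner_integral_nn_integral)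
  have [measurable]: "X \<in> borel_measurable M"
    using distributed_measurable[OF X] by simp
  show "(\<lambda>\<omega>. indicator {..T} (X \<omega>) * exp (- s * X \<omega>)) \<in> borel_measurable M"
    by measurable
  show "0 \<le> l / (l + s) * (1 - exp (- (l + s) * T))"
    using l s T by (intro mult_nonneg_nonneg) (auto intro!: mult_nonpos_nonneg)
  have "(\<integral>\<^sup>+ \<omega>. ennreal (indicator {..T} (X \<omega>) * exp (- s * X \<omega>)) \<partial>M) =
      (\<integral>\<^sup>+ x. exponential_density l x * ennreal (indicator {..T} x * exp (- s * x)) \<partial>lborel)"
    by (subst distributed_nn_integral[OF X, symmetric]) auto
  also have "\<dots> = (\<integral>\<^sup>+ x. ennreal (l / (l + s)) *
      (exponential_density (l + s) x * indicator {..T} x) \<partial>lborel)"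
    using l s
    by (intro nn_integral_cong)
       (auto simp: exponential_density_def ennreal_mult'[symmetric] exp_add[symmetric] field_simps
          split: split_indicator)
  also have "\<dots> = ennreal (l / (l + s)) *
      (\<integral>\<^sup>+ x. ennreal (exponential_density (l + s) x) * indicator {..T} x \<partial>lborel)"
    by (subst nn_integral_cmult)
       (auto simp: ennreal_mult'' ennreal_indicator)
  also have "\<dots> = ennreal (l / (l + s)) * ennreal (erlang_CDF 0 (l + s) T)"
    using l s by (subst nn_integral_erlang_density) auto
  also have "\<dots> = ennreal (l / (l + s) * (1 - exp (- (l + s) * T)))"
    using l s T by (subst ennreal_mult'[symmetric]) (auto simp: erlang_CDF_0)
  finally show "(\<integral>\<^sup>+ \<omega>. ennreal (indicator {..T} (X \<omega>) * exp (- s * X \<omega>)) \<partial>M) =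
    ennreal (l / (l + s) * (1 - exp (- (l + s) * T)))" .
qed (auto split: split_indicator)

text \<open>The same tilting without a cutoff, where the tilted density has total mass 1. The
  conclusion is a \<open>has_bochner_integral\<close> so that it also supplies the integrability
  required when expectations are factored.\<close>

lemma (in prob_space) exponential_distributed_laplace:
  assumes X: "distributed M lborel X (exponential_density l)"
    and l: "0 < l" and s: "0 \<le> s"
  shows "has_bochner_integral M (\<lambda>\<omega>. exp (- s * X \<omega>)) (l / (l + s))"
proof (rule has_bochner_integral_nn_integral)
  have [measurable]: "X \<in> borel_measurable M"
    using distributed_measurable[OF X] by simp
  show "(\<lambda>\<omega>. exp (- s * X \<omega>)) \<in> borel_measurable M"
    by measurable
  show "0 \<le> l / (l + s)"
    using assms by simp
  have "(\<integral>\<^sup>+ \<omega>. ennreal (exp (- s * X \<omega>)) \<partial>M) =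
      (\<integral>\<^sup>+ x. exponential_density l x * ennreal (exp (- s * x)) \<partial>lborel)"
    by (subst distributed_nn_integral[OF X, symmetric]) auto
  also have "\<dots> = (\<integral>\<^sup>+ x. ennreal (l / (l + s)) * exponential_density (l + s) x \<partial>lborel)"
    using l s
    by (intro nn_integral_cong)
       (auto simp: exponential_density_def ennreal_mult'[symmetric] exp_add[symmetric] field_simps)
  \<comment> \<open>The zeroth moment of the density of rate \<open>l + s\<close> is its total mass,
    1.\<close>
  also have "\<dots> = ennreal (l / (l + s))"
    using l s nn_integral_erlang_ith_moment[of "l + s" 0 0] by (subst nn_integral_cmult) auto
  finally show "(\<integral>\<^sup>+ \<omega>. ennreal (exp (- s * X \<omega>)) \<partial>M) = ennreal (l / (l + s))" .
qed auto

text \<open>As \<open>0 \<le> a\<close>, the density is smooth on the whole interval, with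
  antiderivative \<open>- exp (- l * x)\<close>, and the fundamental theorem of calculus
  applies.\<close>

lemma emeasure_exponential_Icc:
  assumes "0 < l" "0 \<le> a" "a \<le> b"
  shows "emeasure (density lborel (exponential_density l)) {a..b} =
    ennreal (exp (- l * a) - exp (- l * b))"
proof -
  have "emeasure (density lborel (exponential_density l)) {a..b} =
      (\<integral>\<^sup>+ x. ennreal (l * exp (- l * x)) * indicator {a..b} x \<partial>lborel)"
    using assms by (subst emeasure_density)
      (auto intro!: nn_integral_cong simp: exponential_density_def mult.commute
        split: split_indicator)
  also have "\<dots> = ennreal (- exp (- l * b) - (- exp (- l * a)))"
    using assms by (intro nn_integral_FTC_Icc) (auto intro!: derivative_eq_intros)
  finally show ?thesis by simp
qed

text \<open>
  The exponential variable is written as \<open>g (V \<omega>)\<close> because \<^const>\<open>prob_space.indep_var\<close> forces both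
  variables to have the same value type.
\<close>

lemma (in prob_space) exponential_hits_random_interval:
  assumes ind: "indep_var N Z N' V"
    and Y: "distributed M lborel (\<lambda>\<omega>. g (V \<omega>)) (exponential_density l)" and l: "0 < l"
    and [measurable]: "a \<in> borel_measurable N" "b \<in> borel_measurable N" "B \<in> sets N"
      "g \<in> borel_measurable N'"
    and ab: "AE \<omega> in M. 0 \<le> a (Z \<omega>) \<and> a (Z \<omega>) \<le> b (Z \<omega>)"
  shows "prob {\<omega> \<in> space M. Z \<omega> \<in> B \<and> a (Z \<omega>) \<le> g (V \<omega>) \<and> g (V \<omega>) \<le> b (Z \<omega>)} =
    expectation (\<lambda>\<omega>. indicator B (Z \<omega>) * (exp (- l * a (Z \<omega>)) - exp (- l * b (Z \<omega>))))"
proof -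
  have [measurable]: "Z \<in> measurable M N" "V \<in> measurable M N'"
    using ind by (auto simp: indep_var_eq)
  interpret V: prob_space "distr M N' V"
    by (rule prob_space_distr) measurable
  have V_Icc: "emeasure (distr M N' V) {v \<in> space N'. x \<le> g v \<and> g v \<le> y} =
      ennreal (exp (- l * x) - exp (- l * y))" if "0 \<le> x" "x \<le> y" for x y
  proof -
    have "emeasure (distr M N' V) {v \<in> space N'. x \<le> g v \<and> g v \<le> y} =
        emeasure M ((\<lambda>\<omega>. g (V \<omega>)) -` {x..y} \<inter> space M)"
      by (subst emeasure_distr)
         (auto intro!: arg_cong[where f="emeasure M"] dest: measurable_space[OF \<open>V \<in> measurable M N'\<close>])
    also have "\<dots> = emeasure (distr M lborel (\<lambda>\<omega>. g (V \<omega>))) {x..y}"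
      by (subst emeasure_distr) auto
    also have "\<dots> = ennreal (exp (- l * x) - exp (- l * y))"
      using that l by (simp add: distributed_distr_eq_density[OF Y] emeasure_exponential_Icc)
    finally show ?thesis .
  qed
  let ?E = "{p \<in> space (N \<Otimes>\<^sub>M N'). fst p \<in> B \<and> a (fst p) \<le> g (snd p) \<and> g (snd p) \<le> b (fst p)}"
  have E: "?E \<in> sets (N \<Otimes>\<^sub>M N')"
    by measurable
  have "emeasure M {\<omega> \<in> space M. Z \<omega> \<in> B \<and> a (Z \<omega>) \<le> g (V \<omega>) \<and> g (V \<omega>) \<le> b (Z \<omega>)} =
      emeasure (distr M (N \<Otimes>\<^sub>M N') (\<lambda>\<omega>. (Z \<omega>, V \<omega>))) ?E"
    by (subst emeasure_distr[OF _ E])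
       (auto simp: space_pair_measure intro!: arg_cong[where f="emeasure M"]
          dest: measurable_space[OF \<open>Z \<in> measurable M N\<close>] measurable_space[OF \<open>V \<in> measurable M N'\<close>])
  \<comment> \<open>Independence makes the joint law a product, so Tonelli can fix the value of
    \<open>Z\<close> and measure the slice under the law of \<open>V\<close> alone.\<close>
  also have "\<dots> = emeasure (distr M N Z \<Otimes>\<^sub>M distr M N' V) ?E"
    using ind by (simp add: indep_var_distribution_eq)
  also have "\<dots> = (\<integral>\<^sup>+ z. emeasure (distr M N' V) (Pair z -` ?E) \<partial>distr M N Z)"
    using E by (intro V.emeasure_pair_measure_alt) (simp cong: sets_pair_measure_cong)
  also have "\<dots> = (\<integral>\<^sup>+ \<omega>. emeasure (distr M N' V) (Pair (Z \<omega>) -` ?E) \<partial>M)"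
    using V.measurable_emeasure_Pair[of ?E N] E
    by (intro nn_integral_distr) (simp_all cong: sets_pair_measure_cong)
  also have "\<dots> = (\<integral>\<^sup>+ \<omega>. ennreal (indicator B (Z \<omega>) *
      (exp (- l * a (Z \<omega>)) - exp (- l * b (Z \<omega>)))) \<partial>M)"
    \<comment> \<open>The interval endpoints are ordered and nonnegative only almost surely, and
      \<open>V_Icc\<close> needs both facts, so the integrands are compared almost
      everywhere.\<close>
    using ab AE_space
  proof (intro nn_integral_cong_AE, eventually_elim)
    fix \<omega> assume ab: "0 \<le> a (Z \<omega>) \<and> a (Z \<omega>) \<le> b (Z \<omega>)" and "\<omega> \<in> space M"
    then have "Pair (Z \<omega>) -` ?E =
        (if Z \<omega> \<in> B then {v \<in> space N'. a (Z \<omega>) \<le> g v \<and> g v \<le> b (Z \<omega>)} else {})"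
      using measurable_space[of Z M N] by (auto simp: space_pair_measure)
    then show "emeasure (distr M N' V) (Pair (Z \<omega>) -` ?E) =
        ennreal (indicator B (Z \<omega>) * (exp (- l * a (Z \<omega>)) - exp (- l * b (Z \<omega>))))"
      using ab by (simp add: V_Icc)
  qed
  finally have *: "ennreal (prob {\<omega> \<in> space M. Z \<omega> \<in> B \<and> a (Z \<omega>) \<le> g (V \<omega>) \<and> g (V \<omega>) \<le> b (Z \<omega>)}) = \<dots>"
    by (simp add: emeasure_eq_measure)
  show ?thesis
  proof (rule has_bochner_integral_integral_eq[symmetric], rule has_bochner_integral_nn_integral)
    show "AE \<omega> in M. 0 \<le> indicator B (Z \<omega>) * (exp (- l * a (Z \<omega>)) - exp (- l * b (Z \<omega>)))"
      using ab by eventually_elim (use l in \<open>auto split: split_indicator\<close>)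
  qed (use * in simp_all)
qed

text \<open>Here \<open>i\<close> is the device that randomizes first and \<open>j\<close> the other
  one. Leaving them symbolic lets one computation serve both orders.\<close>

lemma (in prob_space) exponential_overtaken_within_window:
  fixes W :: "nat \<Rightarrow> 'a \<Rightarrow> real"
  assumes ind: "indep_vars (\<lambda>_. borel) W {..<4}"
    and ij: "{i, j} = {0, 1}"
    and Wi: "distributed M lborel (W i) (exponential_density r)"
    and Wj: "distributed M lborel (W j) (exponential_density r)"
    and W2: "distributed M lborel (W 2) (exponential_density t)"
    and W3: "distributed M lborel (W 3) (exponential_density t)"
    and r: "0 < r" and t: "0 < t" and T: "0 \<le> T"
  shows "prob {\<omega> \<in> space M. W i \<omega> \<le> T \<and> W i \<omega> \<le> W j \<omega> \<and> W j \<omega> \<le> W i \<omega> + (W 2 \<omega> + W 3 \<omega>)} =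
    (1 - exp (- 2 * r * T)) / 2 * (1 - (t / (r + t))\<^sup>2)"
proof -
  let ?S = "\<lambda>\<omega>. W 2 \<omega> + W 3 \<omega>"
  have i: "i \<noteq> j" "i < 2" "j < 2"
    using ij by (auto simp: doubleton_eq_iff)
  \<comment> \<open>\<open>?Z\<close> bundles everything that determines the random interval, and
    \<open>?V\<close> is a one-entry vector holding the time that must hit it. Both are functions on
    \<open>nat\<close>, so their types agree.\<close>
  let ?N = "Pi\<^sub>M {i, 2, 3} (\<lambda>_. borel) :: (nat \<Rightarrow> real) measure"
  let ?Z = "\<lambda>\<omega>. restrict (\<lambda>k. W k \<omega>) {i, 2, 3}" and ?V = "\<lambda>\<omega>. restrict (\<lambda>k. W k \<omega>) {j}"
  have ind1: "indep_var ?N ?Z (Pi\<^sub>M {j} (\<lambda>_. borel)) ?V"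
    using i by (intro indep_var_restrict[OF ind]) auto
  \<comment> \<open>After \<open>W j\<close> is integrated out, two more splittings are needed:
    \<open>W i\<close> from the waiting times, and then the two waiting times from each
    other.\<close>
  have "indep_var (Pi\<^sub>M {i} (\<lambda>_. borel)) (\<lambda>\<omega>. restrict (\<lambda>k. W k \<omega>) {i})
      (Pi\<^sub>M {2, 3} (\<lambda>_. borel)) (\<lambda>\<omega>. restrict (\<lambda>k. W k \<omega>) {2, 3})"
    using i by (intro indep_var_restrict[OF ind]) auto
  then have "indep_var borel ((\<lambda>f. indicator {..T} (f i) * exp (- r * f i)) \<circ> (\<lambda>\<omega>. restrict (\<lambda>k. W k \<omega>) {i}))
      borel ((\<lambda>f. 1 - exp (- r * f 2) * exp (- r * f 3)) \<circ> (\<lambda>\<omega>. restrict (\<lambda>k. W k \<omega>) {2, 3}))"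
    by (rule indep_var_compose) measurable
  then have ind2: "indep_var borel (\<lambda>\<omega>. indicator {..T} (W i \<omega>) * exp (- r * W i \<omega>))
      borel (\<lambda>\<omega>. 1 - exp (- r * W 2 \<omega>) * exp (- r * W 3 \<omega>))"
    by (simp add: comp_def)
  have "indep_var (Pi\<^sub>M {2} (\<lambda>_. borel)) (\<lambda>\<omega>. restrict (\<lambda>k. W k \<omega>) {2})
      (Pi\<^sub>M {3} (\<lambda>_. borel)) (\<lambda>\<omega>. restrict (\<lambda>k. W k \<omega>) {3})"
    by (intro indep_var_restrict[OF ind]) auto
  then have "indep_var borel ((\<lambda>f. exp (- r * f 2)) \<circ> (\<lambda>\<omega>. restrict (\<lambda>k. W k \<omega>) {2}))
      borel ((\<lambda>f. exp (- r * f 3)) \<circ> (\<lambda>\<omega>. restrict (\<lambda>k. W k \<omega>) {3}))"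
    by (rule indep_var_compose) measurable
  then have ind3: "indep_var borel (\<lambda>\<omega>. exp (- r * W 2 \<omega>)) borel (\<lambda>\<omega>. exp (- r * W 3 \<omega>))"
    by (simp add: comp_def)

  note L2 = exponential_distributed_laplace[OF W2 t less_imp_le[OF r]]
  note L3 = exponential_distributed_laplace[OF W3 t less_imp_le[OF r]]
  have int2: "integrable M (\<lambda>\<omega>. exp (- r * W 2 \<omega>))" "integrable M (\<lambda>\<omega>. exp (- r * W 3 \<omega>))"
    using L2 L3 unfolding has_bochner_integral_iff by blast+
  have intS: "integrable M (\<lambda>\<omega>. exp (- r * W 2 \<omega>) * exp (- r * W 3 \<omega>))"
    by (rule indep_var_integrable[OF ind3 int2])
  have ES: "expectation (\<lambda>\<omega>. exp (- r * W 2 \<omega>) * exp (- r * W 3 \<omega>)) = (t / (r + t))\<^sup>2"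
    using indep_var_lebesgue_integral[OF ind3 int2]
      has_bochner_integral_integral_eq[OF L2] has_bochner_integral_integral_eq[OF L3]
    by (simp add: power2_eq_square add.commute)
  have [measurable]: "W i \<in> borel_measurable M"
    using distributed_measurable[OF Wi] by simp
  \<comment> \<open>The truncated integrand is dominated by the untruncated one, which has a finite
    Laplace transform.\<close>
  have inti: "integrable M (\<lambda>\<omega>. indicator {..T} (W i \<omega>) * exp (- r * W i \<omega>))"
  proof (rule Bochner_Integration.integrable_bound)
    show "integrable M (\<lambda>\<omega>. exp (- r * W i \<omega>))"
      using exponential_distributed_laplace[OF Wi r less_imp_le[OF r]]
      unfolding has_bochner_integral_iff by blast
  qed (auto split: split_indicator)

  let ?B = "{f \<in> space ?N. f i \<le> T}"
  have Z_space: "?Z \<omega> \<in> space ?N" for \<omega>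
    by (auto simp: space_PiM)
  have "prob {\<omega> \<in> space M. W i \<omega> \<le> T \<and> W i \<omega> \<le> W j \<omega> \<and> W j \<omega> \<le> W i \<omega> + ?S \<omega>} =
    prob {\<omega> \<in> space M. ?Z \<omega> \<in> ?B \<and> ?Z \<omega> i \<le> ?V \<omega> j \<and> ?V \<omega> j \<le> ?Z \<omega> i + (?Z \<omega> 2 + ?Z \<omega> 3)}"
    using Z_space by simp
  also have "\<dots> = expectation (\<lambda>\<omega>. indicator ?B (?Z \<omega>) *
       (exp (- r * ?Z \<omega> i) - exp (- r * (?Z \<omega> i + (?Z \<omega> 2 + ?Z \<omega> 3)))))"
  proof (rule exponential_hits_random_interval[OF ind1 _ r])
    show "distributed M lborel (\<lambda>\<omega>. ?V \<omega> j) (exponential_density r)"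
      using Wj by simp
    show "AE \<omega> in M. 0 \<le> ?Z \<omega> i \<and> ?Z \<omega> i \<le> ?Z \<omega> i + (?Z \<omega> 2 + ?Z \<omega> 3)"
      using exponential_distributed_nonneg[OF Wi] exponential_distributed_nonneg[OF W2]
        exponential_distributed_nonneg[OF W3]
      by eventually_elim auto
  qed measurable
  \<comment> \<open>Factoring \<open>exp (- r * W i \<omega>)\<close> out of the difference
    separates the window for \<open>W i\<close> from the waiting times.\<close>
  also have "\<dots> = expectation (\<lambda>\<omega>. (indicator {..T} (W i \<omega>) * exp (- r * W i \<omega>)) *
      (1 - exp (- r * W 2 \<omega>) * exp (- r * W 3 \<omega>)))"
    using Z_space by (intro Bochner_Integration.integral_cong)
       (auto simp: exp_add[symmetric] algebra_simps split: split_indicator)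
  also have "\<dots> = expectation (\<lambda>\<omega>. indicator {..T} (W i \<omega>) * exp (- r * W i \<omega>)) *
      expectation (\<lambda>\<omega>. 1 - exp (- r * W 2 \<omega>) * exp (- r * W 3 \<omega>))"
    using intS by (intro indep_var_lebesgue_integral[OF ind2 inti]) simp
  \<comment> \<open>Taking both the rate and the Laplace argument equal to \<open>r\<close> produces
    the factor 1/2 and the exponent \<open>- 2 * r * T\<close>.\<close>
  also have "\<dots> = (1 - exp (- 2 * r * T)) / 2 * (1 - (t / (r + t))\<^sup>2)"
    using r T intS ES exponential_distributed_truncated_laplace[OF Wi r less_imp_le[OF r] T]
    by (simp add: prob_space)
  finally show ?thesis .
qed

theorem theorem1:
  fixes M :: "'a measure"
    and lambda_r lambda_t T B :: real
    and R1 R2 X1 X2 :: "'a \<Rightarrow> real"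
  assumes "lambda_r > 0" and "lambda_t > 0" and "T > 0"
    and "two_device_model M lambda_r lambda_t R1 R2 X1 X2"
    and "B = lambda_r + lambda_t"
  shows "p_mix M T R1 R2 X1 X2
           \<le> lambda_r * (1 / B + lambda_t / B\<^sup>2) * (1 - exp (- 2 * lambda_r * T)) \<and>
         lambda_r * (1 / B + lambda_t / B\<^sup>2) * (1 - exp (- 2 * lambda_r * T))
           \<le> lambda_r * (1 / B + lambda_t / B\<^sup>2)"
proof -
  interpret two_device_model M lambda_r lambda_t R1 R2 X1 X2
    by fact
  let ?W = "\<lambda>i. [R1, R2, X1, X2] ! i"
  have B: "B > 0"
    using assms by simp
  have W: "?W 0 = R1" "?W 1 = R2" "?W 2 = X1" "?W 3 = X2"
    by (auto simp: numeral_eq_Suc)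
  have [measurable]: "R1 \<in> borel_measurable M" "R2 \<in> borel_measurable M"
      "X1 \<in> borel_measurable M" "X2 \<in> borel_measurable M"
    using distributed_measurable[OF distr_R1] distributed_measurable[OF distr_R2]
      distributed_measurable[OF distr_X1] distributed_measurable[OF distr_X2] by auto
  let ?E = "\<lambda>U V. {\<omega> \<in> space M. U \<omega> \<le> T \<and> U \<omega> \<le> V \<omega> \<and> V \<omega> \<le> U \<omega> + (X1 \<omega> + X2 \<omega>)}"
  let ?p = "(1 - exp (- 2 * lambda_r * T)) / 2 * (1 - (lambda_t / (lambda_r + lambda_t))\<^sup>2)"
  have E12: "prob (?E R1 R2) = ?p"
    using exponential_overtaken_within_window[OF indep, of 0 1 lambda_r lambda_t T] W assms
      distr_R1 distr_R2 distr_X1 distr_X2 by simp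
  have E21: "prob (?E R2 R1) = ?p"
    using exponential_overtaken_within_window[OF indep, of 1 0 lambda_r lambda_t T] W assms
      distr_R1 distr_R2 distr_X1 distr_X2 by (simp add: insert_commute)
  \<comment> \<open>Whichever device is first, its time is at most the maximum and hence at most
    \<open>T\<close>. Ties lie in both sets, which does not harm a union bound.\<close>
  have "p_mix M T R1 R2 X1 X2 \<le> prob (?E R1 R2 \<union> ?E R2 R1)"
    unfolding p_mix_def
    by (rule finite_measure_mono)
       (auto simp: devices_mix_def other_transmission_def first_transmission_def)
  also have "\<dots> \<le> prob (?E R1 R2) + prob (?E R2 R1)"
    by (rule measure_Un_le) measurable
  also have "\<dots> = (1 - (lambda_t / B)\<^sup>2) * (1 - exp (- 2 * lambda_r * T))"
    unfolding E12 E21 assms(5) by (simp add: algebra_simps)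
  \<comment> \<open>Difference of squares: \<open>1 - lambda_t / B\<close> equals
    \<open>lambda_r / B\<close>, and the other factor is \<open>1 + lambda_t / B\<close>.\<close>
  also have "1 - (lambda_t / B)\<^sup>2 = lambda_r * (1 / B + lambda_t / B\<^sup>2)"
  proof -
    have "lambda_r = B - lambda_t"
      using assms(5) by simp
    then show ?thesis
      using B by (simp add: divide_simps) (simp add: algebra_simps power2_eq_square)
  qed
  finally show ?thesis
    \<comment> \<open>The second inequality holds because
      \<open>1 - exp (- 2 * lambda_r * T)\<close> is at most 1 and its cofactor is
      nonnegative.\<close>
    using assms B by (auto intro!: mult_left_le)
qed

end
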